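(* Let $d,N\in\mathbb{N}$ with $N\ge 1$, let $L>0$, $R>0$ and $0<h\le 1$. Let $f:\mathbb{R}^d\to\mathbb{R}$ be a convex function in $C^{1,1}_L(\mathbb{R}^d)$ which attains its minimum, and let $x_0\in\mathbb{R}^d$ and a minimizer $x_\ast$ of $f$ be such that $\|x_\ast-x_0\|\le R$. Let $x_1,\dots,x_N\in\mathbb{R}^d$ be generated by the gradient method with constant step size, $$x_{i+1}=x_i-\frac{h}{L}f'(x_i),\qquad i=0,\dots,N-1.$$ Then $$f(x_N)-f(x_\ast)\le \frac{LR^2}{4Nh+2}.$$
   Context: $\|\cdot\|$ is the Euclidean norm on $\mathbb{R}^d$ and $f'(x)$ denotes the gradient of $f$ at $x$. $C^{1,1}_L(\mathbb{R}^d)$ is the class of continuously differentiable functions $f:\mathbb{R}^d\to\mathbb{R}$ with $\|f'(x)-f'(y)\|\le L\|x-y\|$ for all $x,y\in\mathbb{R}^d$. *)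

theory Defs
  imports "HOL-Analysis.Analysis"
begin

text \<open>The gradient with respect to the Euclidean inner product; unspecified where \<open>f\<close> is
  not differentiable.\<close>

definition gradient :: "('a::real_inner \<Rightarrow> real) \<Rightarrow> 'a \<Rightarrow> 'a" where
  "gradient f x = (THE D. GDERIV f x :> D)"

definition C11 :: "real \<Rightarrow> ('a::euclidean_space \<Rightarrow> real) set" where
  "C11 L = {f. (\<forall>x. f differentiable (at x)) \<and> continuous_on UNIV (gradient f) \<and>
               (\<forall>x y. norm (gradient f x - gradient f y) \<le> L * norm (x - y))}"

lemma gradient_eqI:
  assumes "GDERIV f x :> D"
  shows "gradient f x = D"
  unfolding gradient_def
proof (rule the_equality)
  show "GDERIV f x :> D" by (rule assms)
next
  fix E assume "GDERIV f x :> E"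
  then have "(\<lambda>h. inner h E) = (\<lambda>h. inner h D)"
    using assms unfolding gderiv_def by (rule has_derivative_unique)
  then have "inner (E - D) (E - D) = 0"
    by (metis inner_diff_right right_minus_eq)
  then show "E = D" by simp
qed

lemma GDERIV_gradient:
  fixes f :: "'a::euclidean_space \<Rightarrow> real"
  assumes "f differentiable (at x)"
  shows "GDERIV f x :> gradient f x"
proof -
  from assms obtain f' where f': "(f has_derivative f') (at x)"
    by (auto simp: differentiable_def)
  then interpret bounded_linear f' by (rule has_derivative_bounded_linear)
  have "f' = (\<lambda>h. inner h (adjoint f' 1))"
    using adjoint_works[OF linear_axioms, of _ 1] by (simp add: fun_eq_iff)
  with f' have "GDERIV f x :> adjoint f' 1"
    by (metis gderiv_def)
  then show ?thesis using gradient_eqI by metis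
qed

end

theory Submission
  imports Defs
begin

text \<open>
  After division by \<open>L\<close> one may take \<open>L = 1\<close>; write \<open>g\<^sub>i\<close> for the gradient at \<open>x\<^sub>i\<close>,
  \<open>\<phi>\<^sub>i\<close> for the excess of the function value over the minimum, and \<open>z\<close> for the minimizer.
  A smooth convex function satisfies
  \<open>f a + f'(a) \<bullet> (b - a) + \<parallel>f'(a) - f'(b)\<parallel>\<^sup>2 / 2 \<le> f b\<close>
  (lemma \<open>smooth_convex_interpolation\<close>). The proof uses only the \<open>2N + 1\<close> instances of it that
  link consecutive iterates (the chain inequalities)
  or link an iterate to the minimizer (the anchor inequalities).

  The inequality linking \<open>x\<^sub>i\<^sub>-\<^sub>1\<close> and \<open>x\<^sub>i\<close> gets the weight \<open>\<lambda>\<^sub>i = i / (2N + 1 - i)\<close>, the one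
  linking \<open>x\<^sub>i\<close> and \<open>z\<close> gets \<open>\<tau>\<^sub>i = \<lambda>\<^sub>i\<^sub>+\<^sub>1 - \<lambda>\<^sub>i\<close>, with the convention \<open>\<lambda>\<^sub>N\<^sub>+\<^sub>1 = 1\<close>. In the weighted
  sum all function values except \<open>\<phi>\<^sub>N\<close> cancel (summation by parts), and with \<open>u = x\<^sub>0 - z\<close> and
  \<open>G = \<Sum> \<tau>\<^sub>i g\<^sub>i\<close> there remains \<open>\<phi>\<^sub>N \<le> G \<bullet> u - Q\<close>, where \<open>Q\<close> is a quadratic form in the gradients
  that is affine in \<open>h\<close>. By Young's inequality \<open>G \<bullet> u \<le> \<parallel>u\<parallel>\<^sup>2 / (4Nh + 2) + (Nh + 1/2) \<parallel>G\<parallel>\<^sup>2\<close>, so it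
  suffices that \<open>Q \<ge> (Nh + 1/2) \<parallel>G\<parallel>\<^sup>2\<close>. Both sides being affine in \<open>h\<close>, only \<open>h = 0\<close> and
  \<open>h = 1\<close> matter.

  For \<open>h = 0\<close> this is convexity of the squared norm (lemma \<open>norm_anchor_mean_le\<close>). For \<open>h = 1\<close>
  (lemma \<open>norm_anchor_mean_le_unit_step\<close>) the difference \<open>2Q - (2N + 1) \<parallel>G\<parallel>\<^sup>2\<close> vanishes when all
  gradients agree, which suggests to rewrite it as a combination of the squares
  \<open>\<parallel>g\<^sub>i - g\<^sub>j\<parallel>\<^sup>2\<close>. The weights are such that this is possible, and for \<open>i < j\<close> the coefficient is
  \<open>\<tau>\<^sub>j ((2N + 1) \<tau>\<^sub>i - 1)\<close>, which is nonnegative.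
\<close>

section \<open>Smooth convex functions\<close>

lemma has_derivative_along_segment:
  fixes f :: "'a::euclidean_space \<Rightarrow> real"
  assumes "f differentiable (at (x + t *\<^sub>R d))"
  shows "((\<lambda>s. f (x + s *\<^sub>R d)) has_real_derivative gradient f (x + t *\<^sub>R d) \<bullet> d) (at t within S)"
proof -
  have f: "(f has_derivative (\<lambda>v. v \<bullet> gradient f (x + t *\<^sub>R d))) (at (x + t *\<^sub>R d))"
    using GDERIV_gradient[OF assms] by (simp add: gderiv_def)
  have line: "((\<lambda>s. x + s *\<^sub>R d) has_derivative (\<lambda>s. s *\<^sub>R d)) (at t within S)"
    by (auto intro!: derivative_eq_intros)
  have "(\<lambda>s. s *\<^sub>R d \<bullet> gradient f (x + t *\<^sub>R d)) = (*) (gradient f (x + t *\<^sub>R d) \<bullet> d)"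
    by (simp add: fun_eq_iff inner_commute)
  then show ?thesis
    using has_derivative_compose[OF line f] by (simp add: has_field_derivative_def)
qed

text \<open>Restriction to the line through \<open>x\<close> and \<open>y\<close> reduces this to the tangent inequality in one
  variable.\<close>

lemma convex_above_gradient_tangent:
  fixes f :: "'a::euclidean_space \<Rightarrow> real"
  assumes convex: "convex_on UNIV f" and diff: "f differentiable (at x)"
  shows "f x + gradient f x \<bullet> (y - x) \<le> f y"
proof -
  define \<phi> where "\<phi> s = f (x + s *\<^sub>R (y - x))" for s
  have "convex_on UNIV \<phi>"
  proof (rule convex_onI)
    fix t a b :: real assume t: "0 < t" "t < 1"
    have "x + ((1 - t) *\<^sub>R a + t *\<^sub>R b) *\<^sub>R (y - x)
        = (1 - t) *\<^sub>R (x + a *\<^sub>R (y - x)) + t *\<^sub>R (x + b *\<^sub>R (y - x))"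
      by (simp add: algebra_simps)
    then show "\<phi> ((1 - t) *\<^sub>R a + t *\<^sub>R b) \<le> (1 - t) * \<phi> a + t * \<phi> b"
      using convex_onD[OF convex, of t] t by (simp add: \<phi>_def)
  qed simp
  moreover have "(\<phi> has_real_derivative gradient f x \<bullet> (y - x)) (at 0 within UNIV)"
    using has_derivative_along_segment[of f x 0 "y - x"] diff by (simp add: \<phi>_def[abs_def])
  ultimately have "\<phi> 1 - \<phi> 0 \<ge> gradient f x \<bullet> (y - x) * (1 - 0)"
    by (intro convex_on_imp_above_tangent[where A = UNIV]) auto
  then show ?thesis by (simp add: \<phi>_def)
qed

text \<open>Along the segment from \<open>x\<close> to \<open>y\<close> the difference of the two sides has nonpositive derivative,
  because the gradient changes by at most \<open>L\<close> times the distance travelled.\<close>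

lemma C11_quadratic_upper_bound:
  fixes f :: "'a::euclidean_space \<Rightarrow> real"
  assumes "f \<in> C11 L"
  shows "f y \<le> f x + gradient f x \<bullet> (y - x) + L / 2 * (norm (y - x))\<^sup>2"
proof -
  define d where "d = y - x"
  define \<phi> where "\<phi> t = f (x + t *\<^sub>R d) - t * (gradient f x \<bullet> d) - L / 2 * t\<^sup>2 * (norm d)\<^sup>2" for t
  have diff: "f differentiable (at z)" for z
    using assms by (simp add: C11_def)
  have "\<phi> 1 \<le> \<phi> 0"
  proof (rule DERIV_nonpos_imp_nonincreasing[of 0 1 \<phi>])
    fix t :: real assume t: "0 \<le> t" "t \<le> 1"
    have deriv: "(\<phi> has_real_derivative gradient f (x + t *\<^sub>R d) \<bullet> d - gradient f x \<bullet> d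
        - L * t * (norm d)\<^sup>2) (at t)"
      unfolding \<phi>_def[abs_def]
      by (rule derivative_eq_intros has_derivative_along_segment diff refl | simp)+
    have "(gradient f (x + t *\<^sub>R d) - gradient f x) \<bullet> d
        \<le> norm (gradient f (x + t *\<^sub>R d) - gradient f x) * norm d"
      by (rule norm_cauchy_schwarz)
    also have "\<dots> \<le> (L * norm (x + t *\<^sub>R d - x)) * norm d"
      using assms unfolding C11_def by (intro mult_right_mono norm_ge_zero) blast
    also have "\<dots> = L * t * (norm d)\<^sup>2"
      using t by (simp add: power2_eq_square)
    finally show "\<exists>D. (\<phi> has_real_derivative D) (at t) \<and> D \<le> 0"
      using deriv by (auto simp: inner_diff_left)
  qed simp
  then show ?thesis by (simp add: \<phi>_def d_def)
qed

text \<open>The tangent at \<open>x\<close> bounds \<open>f\<close> from below everywhere, the parabola at \<open>y\<close> bounds it from above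
  everywhere. Comparing both at the point \<open>z\<close> where the parabola exceeds the tangent the least gives
  the quadratic gain over the tangent inequality.\<close>

lemma smooth_convex_interpolation:
  fixes f :: "'a::euclidean_space \<Rightarrow> real"
  assumes "L > 0" and convex: "convex_on UNIV f" and C11: "f \<in> C11 L"
  shows "f x + gradient f x \<bullet> (y - x) + (norm (gradient f x - gradient f y))\<^sup>2 / (2 * L) \<le> f y"
proof -
  define e where "e = gradient f y - gradient f x"
  define z where "z = y - (1 / L) *\<^sub>R e"
  have "f x + gradient f x \<bullet> (z - x) \<le> f z"
    using C11 by (intro convex_above_gradient_tangent convex) (simp add: C11_def)
  also have "f z \<le> f y + gradient f y \<bullet> (z - y) + L / 2 * (norm (z - y))\<^sup>2"
    by (rule C11_quadratic_upper_bound[OF C11])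
  also have "\<dots> = f y - (gradient f y \<bullet> e) / L + (e \<bullet> e) / (2 * L)"
    using \<open>L > 0\<close> by (simp add: z_def power_divide)
        (simp add: power2_norm_eq_inner power2_eq_square[of L])
  also have "\<dots> = f y - (gradient f x \<bullet> e) / L - (e \<bullet> e) / (2 * L)"
  proof -
    have "gradient f y \<bullet> e = gradient f x \<bullet> e + e \<bullet> e"
      by (simp add: e_def inner_diff_left)
    then show ?thesis using \<open>L > 0\<close> by (simp add: field_simps)
  qed
  finally have "f x + gradient f x \<bullet> (y - x) + (e \<bullet> e) / (2 * L) \<le> f y"
    by (simp add: z_def inner_diff_right algebra_simps)
  moreover have "e \<bullet> e = (norm (gradient f x - gradient f y))\<^sup>2"
    by (simp add: e_def power2_norm_eq_inner[symmetric] norm_minus_commute)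
  ultimately show ?thesis by simp
qed

section \<open>Identities for finite sums\<close>

text \<open>If the weights sum to one, this is the formula for a variance in terms of pairwise
  distances.\<close>

lemma sum_weighted_pair_distances:
  fixes g :: "nat \<Rightarrow> 'a::real_inner"
  shows "(\<Sum>j<n. \<Sum>i<j. a i * a j * (norm (g i - g j))\<^sup>2)
    = (\<Sum>i<n. a i) * (\<Sum>i<n. a i * (norm (g i))\<^sup>2) - (norm (\<Sum>i<n. a i *\<^sub>R g i))\<^sup>2"
proof (induction n)
  case (Suc n)
  define A where "A = (\<Sum>i<n. a i)"
  define B where "B = (\<Sum>i<n. a i * (norm (g i))\<^sup>2)"
  define S where "S = (\<Sum>i<n. a i *\<^sub>R g i)"
  have "(\<Sum>i<n. a i * a n * (norm (g i - g n))\<^sup>2)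
      = (\<Sum>i<n. a n * (a i * (norm (g i))\<^sup>2) - 2 * a n * ((a i *\<^sub>R g i) \<bullet> g n)
          + a n * (norm (g n))\<^sup>2 * a i)"
    by (intro sum.cong refl)
      (simp add: power2_norm_eq_inner inner_diff_left inner_diff_right inner_commute algebra_simps)
  also have "\<dots> = a n * B - 2 * a n * (S \<bullet> g n) + a n * (norm (g n))\<^sup>2 * A"
    by (simp add: sum.distrib sum_subtractf sum_distrib_left inner_sum_left A_def B_def S_def)
  finally show ?case
    using Suc.IH
    by (simp flip: A_def B_def S_def)
      (simp add: power2_norm_eq_inner inner_add_left inner_add_right inner_commute algebra_simps)
qed simp

text \<open>With \<open>a\<close> the chain weights and \<open>b\<close> the function values, this is what leaves only the last
  function value in the weighted sum of all inequalities.\<close>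

lemma sum_by_parts_increments:
  fixes a b :: "nat \<Rightarrow> real"
  shows "(\<Sum>i\<le>n. (a (Suc i) - a i) * b i) + (\<Sum>i<n. a (Suc i) * (b (Suc i) - b i))
    = a (Suc n) * b n - a 0 * b 0"
  by (induction n) (simp_all add: algebra_simps)

lemma sum_increments_times_partial_sums:
  fixes a b :: "nat \<Rightarrow> real"
  shows "(\<Sum>j\<le>n. (a (Suc j) - a j) * (\<Sum>i<j. b i)) = (\<Sum>i\<le>n. (a (Suc n) - a (Suc i)) * b i)"
proof (induction n)
  case (Suc n)
  have "(\<Sum>i\<le>n. (a (Suc (Suc n)) - a (Suc i)) * b i)
     = (\<Sum>i\<le>n. (a (Suc n) - a (Suc i)) * b i + (a (Suc (Suc n)) - a (Suc n)) * b i)"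
    by (intro sum.cong refl) (simp add: algebra_simps)
  then show ?case using Suc.IH
    by (simp add: sum.distrib sum_distrib_left lessThan_Suc_atMost)
qed simp

section \<open>The multipliers\<close>

text \<open>The multiplier of the inequality between the iterates \<open>i - 1\<close> and \<open>i\<close>. The value \<open>1\<close> beyond
  \<open>N\<close> corresponds to no inequality; it makes every anchor weight, including the last one, an
  increment of chain weights.\<close>

definition chain_weight :: "nat \<Rightarrow> nat \<Rightarrow> real" where
  "chain_weight N i = (if i \<le> N then real i / (2 * real N + 1 - real i) else 1)"

text \<open>The multiplier of the inequality between iterate \<open>i\<close> and the minimizer.\<close>

definition anchor_weight :: "nat \<Rightarrow> nat \<Rightarrow> real" where
  "anchor_weight N i = chain_weight N (Suc i) - chain_weight N i"

lemma chain_weight_0 [simp]: "chain_weight N 0 = 0"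
  by (simp add: chain_weight_def)

lemma chain_weight_Suc_N [simp]: "chain_weight N (Suc N) = 1"
  by (simp add: chain_weight_def)

lemma chain_weight_nonneg: "0 \<le> chain_weight N i"
  by (simp add: chain_weight_def)

lemma anchor_weight_eq:
  assumes "i < N"
  shows "anchor_weight N i = (2 * real N + 1) / ((2 * real N - real i) * (2 * real N + 1 - real i))"
proof -
  have "real i < real N" using assms by simp
  then have "2 * real N - real i \<noteq> 0" "2 * real N + 1 - real i \<noteq> 0" by linarith+
  moreover have "2 * real N + 1 - real (Suc i) = 2 * real N - real i" by simp
  ultimately show ?thesis using assms
    by (simp add: anchor_weight_def chain_weight_def divide_simps) (simp add: algebra_simps)
qed

lemma anchor_weight_last: "anchor_weight N N = 1 / (real N + 1)"
  by (simp add: anchor_weight_def chain_weight_def field_simps)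

lemma anchor_weight_nonneg:
  assumes "i \<le> N"
  shows "0 \<le> anchor_weight N i"
proof (cases "i = N")
  case False
  then show ?thesis using assms by (simp add: anchor_weight_eq)
qed (simp add: anchor_weight_last)

lemma sum_anchor_weight: "(\<Sum>i\<le>N. anchor_weight N i) = 1"
  using sum_lessThan_telescope[of "chain_weight N" "Suc N"]
  by (simp add: anchor_weight_def lessThan_Suc_atMost del: sum.lessThan_Suc sum.atMost_Suc)

text \<open>This makes the coefficients of the sum of squares for \<open>h = 1\<close> nonnegative.\<close>

lemma anchor_weight_lower_bound:
  assumes "i < N"
  shows "1 \<le> (2 * real N + 1) * anchor_weight N i"
proof -
  have i: "real i < real N" using assms by simp
  then have "(2 * real N - real i) * (2 * real N + 1 - real i) \<le> (2 * real N + 1) * (2 * real N + 1)"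
    by (intro mult_mono) auto
  moreover have "0 < (2 * real N - real i) * (2 * real N + 1 - real i)"
    using i by (intro mult_pos_pos) linarith+
  ultimately show ?thesis using assms by (simp add: anchor_weight_eq)
qed

text \<open>The equation that the coefficient of \<open>\<parallel>g\<^sub>i\<parallel>\<^sup>2\<close> must satisfy for the quadratic form at \<open>h = 1\<close> to be
  a combination of squared differences. Together with the increment relation it is a recursion
  that, started at \<open>0\<close>, determines the chain weights up to \<open>N\<close>.\<close>

lemma weight_balance:
  assumes "i < N"
  shows "(2 * real N - real i) * anchor_weight N i = 1 + chain_weight N i"
proof -
  have "real i < real N" using assms by simp
  then have "2 * real N - real i \<noteq> 0" "2 * real N + 1 - real i \<noteq> 0" by linarith+
  then show ?thesis using assms
    by (simp add: anchor_weight_eq chain_weight_def divide_simps)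
qed

lemma weight_balance_last: "real N * anchor_weight N N = chain_weight N N"
  by (simp add: anchor_weight_last chain_weight_def)

section \<open>The quadratic form in the gradients\<close>

lemma norm_anchor_mean_le:
  fixes g :: "nat \<Rightarrow> 'a::real_inner"
  shows "(norm (\<Sum>i\<le>N. anchor_weight N i *\<^sub>R g i))\<^sup>2 \<le> (\<Sum>i\<le>N. anchor_weight N i * (norm (g i))\<^sup>2)"
proof -
  have "0 \<le> (\<Sum>j<Suc N. \<Sum>i<j. anchor_weight N i * anchor_weight N j * (norm (g i - g j))\<^sup>2)"
    by (intro sum_nonneg mult_nonneg_nonneg anchor_weight_nonneg) auto
  then show ?thesis
    unfolding sum_weighted_pair_distances unfolding lessThan_Suc_atMost sum_anchor_weight by simp
qed

text \<open>Right side minus left side equals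
  \<open>\<Sum>\<^sub>i\<^sub><\<^sub>j \<tau>\<^sub>j ((2N + 1) \<tau>\<^sub>i - 1) \<parallel>g\<^sub>i - g\<^sub>j\<parallel>\<^sup>2\<close>: the products \<open>\<tau>\<^sub>i \<tau>\<^sub>j\<close> produce the
  variance \<open>\<Sum> \<tau>\<^sub>i \<parallel>g\<^sub>i\<parallel>\<^sup>2 - \<parallel>G\<parallel>\<^sup>2\<close>, the terms with \<open>-\<tau>\<^sub>j\<close> produce the inner products
  with the partial sums of the gradients, and \<open>weight_balance\<close> matches the remaining diagonal
  terms.\<close>

lemma norm_anchor_mean_le_unit_step:
  fixes g :: "nat \<Rightarrow> 'a::real_inner"
  shows "(2 * real N + 1) * (norm (\<Sum>i\<le>N. anchor_weight N i *\<^sub>R g i))\<^sup>2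
    \<le> 2 * (\<Sum>j\<le>N. anchor_weight N j * ((\<Sum>i<j. g i) \<bullet> g j))
      + (\<Sum>i<N. chain_weight N (Suc i) * ((norm (g i))\<^sup>2 + (norm (g (Suc i)))\<^sup>2))
      + (\<Sum>i\<le>N. anchor_weight N i * (norm (g i))\<^sup>2)"
proof -
  let ?c = "chain_weight N" and ?t = "anchor_weight N"
  define q where "q i = (norm (g i))\<^sup>2" for i
  define G where "G = (\<Sum>i\<le>N. ?t i *\<^sub>R g i)"
  define C where "C = (\<Sum>j\<le>N. ?t j * ((\<Sum>i<j. g i) \<bullet> g j))"
  have weighted: "(\<Sum>j\<le>N. \<Sum>i<j. ?t i * ?t j * (norm (g i - g j))\<^sup>2) = (\<Sum>i\<le>N. ?t i * q i) - (norm G)\<^sup>2"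
    using sum_weighted_pair_distances[of ?t g "Suc N"]
    unfolding lessThan_Suc_atMost sum_anchor_weight by (simp add: q_def G_def)
  have one_sided: "(\<Sum>j\<le>N. \<Sum>i<j. ?t j * (norm (g i - g j))\<^sup>2)
      = (\<Sum>j\<le>N. (1 - ?c (Suc j) + real j * ?t j) * q j) - 2 * C"
  proof -
    have "(\<Sum>i<j. ?t j * (norm (g i - g j))\<^sup>2)
        = ?t j * (\<Sum>i<j. q i) + real j * ?t j * q j - 2 * (?t j * ((\<Sum>i<j. g i) \<bullet> g j))" for j
    proof -
      have "(\<Sum>i<j. ?t j * (norm (g i - g j))\<^sup>2)
          = (\<Sum>i<j. ?t j * q i + ?t j * q j - 2 * ?t j * (g i \<bullet> g j))"
        by (intro sum.cong refl) (simp add: q_def power2_norm_eq_inner inner_diff_left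
            inner_diff_right inner_commute algebra_simps)
      then show ?thesis
        by (simp add: sum.distrib sum_subtractf sum_distrib_left inner_sum_left mult.assoc)
    qed
    then have "(\<Sum>j\<le>N. \<Sum>i<j. ?t j * (norm (g i - g j))\<^sup>2)
        = (\<Sum>j\<le>N. ?t j * (\<Sum>i<j. q i)) + (\<Sum>j\<le>N. real j * ?t j * q j) - 2 * C"
      by (simp add: sum.distrib sum_subtractf sum_distrib_left C_def)
    also have "(\<Sum>j\<le>N. ?t j * (\<Sum>i<j. q i)) = (\<Sum>j\<le>N. (1 - ?c (Suc j)) * q j)"
      using sum_increments_times_partial_sums[of ?c q N] by (simp add: anchor_weight_def)
    finally show ?thesis by (simp add: sum.distrib[symmetric] algebra_simps)
  qed
  have chain: "(\<Sum>i<N. ?c (Suc i) * (q i + q (Suc i)))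
      = (\<Sum>i<N. (?c (Suc i) + ?c i) * q i) + ?c N * q N"
  proof -
    have "(\<Sum>i<N. ?c (Suc i) * q (Suc i)) = (\<Sum>i<N. ?c i * q i) + ?c N * q N"
      using sum.lessThan_Suc_shift[of "\<lambda>i. ?c i * q i" N] by simp
    then show ?thesis by (simp add: sum.distrib algebra_simps)
  qed
  have coefficients: "(2 * real N + 1) * (\<Sum>i\<le>N. ?t i * q i)
      - (\<Sum>j\<le>N. (1 - ?c (Suc j) + real j * ?t j) * q j)
      = (\<Sum>i<N. ?c (Suc i) * (q i + q (Suc i))) + (\<Sum>i\<le>N. ?t i * q i)"
  proof -
    have "2 * real N * ?t i - (1 - ?c (Suc i) + real i * ?t i) = ?c (Suc i) + ?c i" if "i < N" for i
      using weight_balance[OF that] by (simp add: algebra_simps)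
    then have "(\<Sum>i<N. (2 * real N * ?t i - (1 - ?c (Suc i) + real i * ?t i)) * q i)
        = (\<Sum>i<N. (?c (Suc i) + ?c i) * q i)"
      by (intro sum.cong) auto
    moreover have "(2 * real N * ?t N - (1 - ?c (Suc N) + real N * ?t N)) * q N = ?c N * q N"
      using weight_balance_last[of N] by simp
    ultimately have "(\<Sum>i\<le>N. (2 * real N * ?t i - (1 - ?c (Suc i) + real i * ?t i)) * q i)
        = (\<Sum>i<N. ?c (Suc i) * (q i + q (Suc i)))"
      unfolding chain lessThan_Suc_atMost[symmetric] sum.lessThan_Suc by simp
    moreover have "(\<Sum>i\<le>N. (2 * real N * ?t i - (1 - ?c (Suc i) + real i * ?t i)) * q i)
        = 2 * real N * (\<Sum>i\<le>N. ?t i * q i) - (\<Sum>j\<le>N. (1 - ?c (Suc j) + real j * ?t j) * q j)"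
      by (simp add: left_diff_distrib sum_subtractf sum_distrib_left mult.assoc)
    ultimately show ?thesis by (simp add: algebra_simps)
  qed
  have "0 \<le> (\<Sum>j\<le>N. \<Sum>i<j. ?t j * ((2 * real N + 1) * ?t i - 1) * (norm (g i - g j))\<^sup>2)"
    by (intro sum_nonneg mult_nonneg_nonneg anchor_weight_nonneg) (auto simp: anchor_weight_lower_bound)
  also have "\<dots> = (2 * real N + 1) * (\<Sum>j\<le>N. \<Sum>i<j. ?t i * ?t j * (norm (g i - g j))\<^sup>2)
      - (\<Sum>j\<le>N. \<Sum>i<j. ?t j * (norm (g i - g j))\<^sup>2)"
    unfolding sum_distrib_left sum_subtractf[symmetric]
    by (intro sum.cong refl) (simp add: algebra_simps)
  also have "\<dots> = (2 * real N + 1) * (\<Sum>i\<le>N. ?t i * q i) - (2 * real N + 1) * (norm G)\<^sup>2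
      - (\<Sum>j\<le>N. (1 - ?c (Suc j) + real j * ?t j) * q j) + 2 * C"
    unfolding weighted one_sided by (simp add: algebra_simps)
  finally show ?thesis
    using coefficients unfolding q_def G_def C_def by linarith
qed

section \<open>The bound for gradient steps\<close>

text \<open>The convergence bound depends only on the inequalities among iterates, gradients and function
  values, so it is stated for arbitrary sequences obeying them, normalized to \<open>L = 1\<close> and minimal
  value \<open>0\<close>.\<close>

lemma gradient_chain_bound:
  fixes x g :: "nat \<Rightarrow> 'a::real_inner" and \<phi> :: "nat \<Rightarrow> real"
  assumes h: "0 \<le> h" "h \<le> 1"
    and step: "\<And>i. i < N \<Longrightarrow> x (Suc i) = x i - h *\<^sub>R g i"
    and chain: "\<And>i. i < N \<Longrightarrow>
      \<phi> (Suc i) + g (Suc i) \<bullet> (x i - x (Suc i)) + (norm (g i - g (Suc i)))\<^sup>2 / 2 \<le> \<phi> i"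
    and anchor: "\<And>i. i \<le> N \<Longrightarrow> \<phi> i + (norm (g i))\<^sup>2 / 2 \<le> g i \<bullet> (x i - z)"
  shows "\<phi> N \<le> (norm (x 0 - z))\<^sup>2 / (4 * real N * h + 2)"
proof -
  let ?c = "chain_weight N" and ?t = "anchor_weight N"
  define u where "u = x 0 - z"
  define q where "q i = (norm (g i))\<^sup>2" for i
  define G where "G = (\<Sum>i\<le>N. ?t i *\<^sub>R g i)"
  define C where "C = (\<Sum>j\<le>N. ?t j * ((\<Sum>i<j. g i) \<bullet> g j))"
  define D where "D = (\<Sum>i<N. ?c (Suc i) * (q i + q (Suc i)))"
  define T where "T = (\<Sum>i\<le>N. ?t i * q i)"
  have position: "x i - z = u - h *\<^sub>R (\<Sum>j<i. g j)" if "i \<le> N" for i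
    using that by (induction i) (simp_all add: u_def step algebra_simps)
  have "(\<Sum>i\<le>N. ?t i * (\<phi> i + q i / 2)) \<le> (\<Sum>i\<le>N. ?t i * (g i \<bullet> (x i - z)))"
    by (intro sum_mono mult_left_mono) (auto simp: q_def anchor anchor_weight_nonneg)
  also have "\<dots> = (\<Sum>i\<le>N. (?t i *\<^sub>R g i) \<bullet> u - h * (?t i * ((\<Sum>j<i. g j) \<bullet> g i)))"
    by (intro sum.cong refl) (simp add: position inner_diff_right inner_commute algebra_simps)
  also have "\<dots> = G \<bullet> u - h * C"
    by (simp add: sum_subtractf sum_distrib_left inner_sum_left G_def C_def)
  finally have anchors: "(\<Sum>i\<le>N. ?t i * \<phi> i) + T / 2 \<le> G \<bullet> u - h * C"
    by (simp add: T_def distrib_left sum.distrib sum_divide_distrib)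
  have link: "\<phi> (Suc i) - \<phi> i + h / 2 * (q i + q (Suc i)) \<le> 0" if "i < N" for i
  proof -
    \<comment> \<open>Since \<open>x i - x (Suc i) = h *\<^sub>R g i\<close>, a fraction \<open>h\<close> of the square absorbs the inner product;
      the rest is nonnegative and can be dropped.\<close>
    have "g (Suc i) \<bullet> (x i - x (Suc i)) + (norm (g i - g (Suc i)))\<^sup>2 / 2
        = h / 2 * (q i + q (Suc i)) + (1 - h) / 2 * (norm (g i - g (Suc i)))\<^sup>2"
      using that by (simp add: step q_def power2_norm_eq_inner inner_diff_left inner_diff_right
          inner_commute field_simps)
    moreover have "0 \<le> (1 - h) / 2 * (norm (g i - g (Suc i)))\<^sup>2" using h by simp
    ultimately show ?thesis using chain[OF that] by linarith
  qed
  have "(\<Sum>i<N. ?c (Suc i) * (\<phi> (Suc i) - \<phi> i + h / 2 * (q i + q (Suc i)))) \<le> 0"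
    by (intro sum_nonpos mult_nonneg_nonpos chain_weight_nonneg link) simp
  then have chains: "(\<Sum>i<N. ?c (Suc i) * (\<phi> (Suc i) - \<phi> i)) + h / 2 * D \<le> 0"
    by (simp add: D_def distrib_left sum.distrib sum_distrib_left mult.left_commute)
  have "(\<Sum>i\<le>N. ?t i * \<phi> i) + (\<Sum>i<N. ?c (Suc i) * (\<phi> (Suc i) - \<phi> i)) = \<phi> N"
    using sum_by_parts_increments[of ?c \<phi> N] by (simp add: anchor_weight_def)
  with anchors chains have "\<phi> N \<le> G \<bullet> u - h * C - h / 2 * D - T / 2"
    by linarith
  \<comment> \<open>Interpolation between the cases \<open>h = 1\<close> and \<open>h = 0\<close>.\<close>
  also have "\<dots> = G \<bullet> u - h / 2 * (2 * C + D + T) - (1 - h) / 2 * T"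
    by (simp add: field_simps)
  also have "\<dots> \<le> G \<bullet> u - h / 2 * ((2 * real N + 1) * (norm G)\<^sup>2) - (1 - h) / 2 * (norm G)\<^sup>2"
    using norm_anchor_mean_le_unit_step[of N g] norm_anchor_mean_le[of N g] h
    by (intro diff_mono mult_left_mono order_refl) (auto simp: G_def C_def D_def T_def q_def)
  also have "\<dots> = G \<bullet> u - (4 * real N * h + 2) / 4 * (norm G)\<^sup>2"
    by (simp add: field_simps)
  also have "\<dots> \<le> (norm u)\<^sup>2 / (4 * real N * h + 2)"
  proof -
    define m where "m = 4 * real N * h + 2"
    have "m > 0" using h by (simp add: m_def add_nonneg_pos)
    \<comment> \<open>Young's inequality, by completing the square in \<open>u\<close>.\<close>
    have "(norm (u - (m / 2) *\<^sub>R G))\<^sup>2 = (norm u)\<^sup>2 - m * (G \<bullet> u) + m\<^sup>2 / 4 * (norm G)\<^sup>2"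
      by (simp add: power2_norm_eq_inner inner_diff_left inner_diff_right inner_commute
          power2_eq_square[of m] field_simps)
    then have "0 \<le> ((norm u)\<^sup>2 - m * (G \<bullet> u) + m\<^sup>2 / 4 * (norm G)\<^sup>2) / m"
      using \<open>m > 0\<close> by (metis zero_le_divide_iff zero_le_power2 less_imp_le)
    also have "\<dots> = (norm u)\<^sup>2 / m - G \<bullet> u + m / 4 * (norm G)\<^sup>2"
      using \<open>m > 0\<close> by (simp add: field_simps power2_eq_square)
    finally show ?thesis by (simp add: m_def)
  qed
  finally show ?thesis by (simp add: u_def)
qed

theorem theorem3p1:
  fixes f :: "real ^ 'd \<Rightarrow> real"
    and x :: "nat \<Rightarrow> real ^ 'd"
    and xstar :: "real ^ 'd"
    and L R h :: real
    and N :: nat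
  assumes "N \<ge> 1" and "L > 0" and "R > 0" and "0 < h" and "h \<le> 1"
    and "convex_on UNIV f"
    and "f \<in> C11 L"
    and "\<forall>y. f xstar \<le> f y"
    and "norm (xstar - x 0) \<le> R"
    and "\<forall>i<N. x (Suc i) = x i - (h / L) *\<^sub>R gradient f (x i)"
  shows "f (x N) - f xstar \<le> L * R\<^sup>2 / (4 * real N * h + 2)"
proof -
  define g where "g i = (1 / L) *\<^sub>R gradient f (x i)" for i
  define \<phi> where "\<phi> i = (f (x i) - f xstar) / L" for i
  note interpolation = smooth_convex_interpolation[OF \<open>L > 0\<close> \<open>convex_on UNIV f\<close> \<open>f \<in> C11 L\<close>]
  have stationary: "gradient f xstar = 0"
  proof -
    \<comment> \<open>A gradient step of size \<open>1 / L\<close> from a minimizer cannot decrease \<open>f\<close>.\<close>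
    have "f xstar \<le> f (xstar - (1 / L) *\<^sub>R gradient f xstar)"
      using assms by blast
    also have "\<dots> \<le> f xstar - (norm (gradient f xstar))\<^sup>2 / (2 * L)"
      using C11_quadratic_upper_bound[OF \<open>f \<in> C11 L\<close>, of "xstar - (1 / L) *\<^sub>R gradient f xstar" xstar] \<open>L > 0\<close>
      by (simp add: power_divide power2_norm_eq_inner power2_eq_square[of L])
    finally have "(norm (gradient f xstar))\<^sup>2 \<le> 0"
      using \<open>L > 0\<close> by (simp add: field_simps)
    then show ?thesis by simp
  qed
  have norm_diff_g: "(norm (g i - g j))\<^sup>2 / 2 = (norm (gradient f (x j) - gradient f (x i)))\<^sup>2 / (2 * L) / L" for i j
  proof -
    have "norm (g i - g j) = norm (gradient f (x j) - gradient f (x i)) / L"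
      using \<open>L > 0\<close> by (simp add: g_def norm_minus_commute flip: scaleR_diff_right)
    then show ?thesis by (simp add: power_divide power2_eq_square)
  qed
  have "\<phi> N \<le> (norm (x 0 - xstar))\<^sup>2 / (4 * real N * h + 2)"
  proof (rule gradient_chain_bound)
    fix i assume "i < N"
    then show "x (Suc i) = x i - h *\<^sub>R g i" using assms by (simp add: g_def)
    show "\<phi> (Suc i) + g (Suc i) \<bullet> (x i - x (Suc i)) + (norm (g i - g (Suc i)))\<^sup>2 / 2 \<le> \<phi> i"
      using divide_right_mono[OF interpolation[of "x (Suc i)" "x i"], of L] \<open>L > 0\<close>
      unfolding norm_diff_g by (simp add: \<phi>_def g_def add_divide_distrib diff_divide_distrib)
  next
    fix i assume "i \<le> N"
    have "(norm (g i))\<^sup>2 / 2 = (norm (gradient f (x i) - gradient f xstar))\<^sup>2 / (2 * L) / L"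
      using \<open>L > 0\<close> by (simp add: g_def stationary power_divide power2_eq_square)
    then show "\<phi> i + (norm (g i))\<^sup>2 / 2 \<le> g i \<bullet> (x i - xstar)"
      using divide_right_mono[OF interpolation[of "x i" xstar], of L] \<open>L > 0\<close>
      by (simp add: \<phi>_def g_def add_divide_distrib diff_divide_distrib inner_diff_right)
  qed (use assms in auto)
  also have "\<dots> \<le> R\<^sup>2 / (4 * real N * h + 2)"
    using assms by (intro divide_right_mono power_mono) (auto simp: norm_minus_commute)
  finally show ?thesis
    using \<open>L > 0\<close> by (simp add: \<phi>_def divide_le_eq mult.commute)
qed

end
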